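(* Let $\beta_1,\beta_2>0$ be real numbers and $f\in\mathcal{A}$. Let $$S_f(z):=1+\beta_1(S_2-S_1^2+S_1)+\beta_2(S_3+2S_2+2S_1^3-2S_1^2-3S_1S_2),$$ where $S_1=zf'(z)/f(z)$, $S_2=z^2f''(z)/f(z)$ and $S_3=z^3f'''(z)/f(z)$. Then $f\in\mathcal{S}^*_\rho$ if any one of the following conditions holds: (i) $S_f(z)\prec\sqrt{1+z}$ and $(2\beta_1-\beta_2)(2\beta_1-\beta_2-4\sqrt{2})\geq 8$. (ii) $S_f(z)\prec (1+Cz)/(1+Dz)$ and $(2\beta_1-\beta_2)(1-D^2)\geq 2\sqrt{2}\,(C-D)(1+|D|)$, where $-1<D<C\leq 1$. (iii) $S_f(z)\prec 2/(1+e^{-z})$ and $2\beta_1-\beta_2\geq 2\sqrt{2}\,r_0$, where $r_0\approx 0.546302$ is the positive root of the equation $r^2+2\cot(1)\,r-1=0$. (iv) $S_f(z)\prec z+\sqrt{1+z^2}$ and $2\beta_1-\beta_2\geq 4$. (v) $S_f(z)\prec 1+\sin z$ and $2\beta_1-\beta_2\geq 2\sqrt{2}\sinh 1$. (vi) $S_f(z)\prec 1+ze^z$ and $2\beta_1-\beta_2\geq 2\sqrt{2}\,e$. (vii) $S_f(z)\prec e^z$ and $2\beta_1-\beta_2\geq 2\sqrt{2}(e-1)$. (viii) $S_f(z)\prec 1+\sinh^{-1}z$ and $2\beta_1-\beta_2\geq\sqrt{2}\,\pi$.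
   Context: $\mathbb{D}=\{z\in\mathbb{C}:|z|<1\}$. $\mathcal{A}$ is the class of analytic functions on $\mathbb{D}$ of the form $f(z)=z+a_2z^2+a_3z^3+\cdots$. For functions $f,g$ analytic in $\mathbb{D}$, $f\prec g$ ($f$ is subordinate to $g$) means there is an analytic $w:\mathbb{D}\to\mathbb{C}$ with $w(0)=0$ and $|w(z)|\leq|z|$ such that $f(z)=g(w(z))$ for all $z\in\mathbb{D}$. $\mathcal{S}^*_\rho$ is the class of $f\in\mathcal{A}$ with $zf'(z)/f(z)\prec 1+\sinh^{-1}z$. Quotients such as $zf'(z)/f(z)$ are understood with their removable singularity at $0$ filled in. The square root is the principal branch, and $\sinh^{-1}z=\log(z+\sqrt{1+z^2})$ is the principal branch of the inverse hyperbolic sine, analytic on $\mathbb{D}$ with value $0$ at $0$.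
   Formalization: Condition (i) additionally requires 2β₁−β₂>0; without it the claim fails, e.g. for β₁=1/10, β₂=10, f(z)=ze^{4z}, where S_f=1+2z/5≺√(1+z) and the inequality holds, but zf'/f=1+4z is not subordinate to 1+sinh⁻¹z. *)

theory Defs
  imports "HOL-Complex_Analysis.Complex_Analysis"
begin

definition class_A :: "(complex \<Rightarrow> complex) set" where
  "class_A = {f. f holomorphic_on ball 0 1 \<and>
     (\<exists>a :: nat \<Rightarrow> complex. \<forall>z\<in>ball 0 1. (\<lambda>n. a (n + 2) * z ^ (n + 2)) sums (f z - z))}"

definition subordinate :: "(complex \<Rightarrow> complex) \<Rightarrow> (complex \<Rightarrow> complex) \<Rightarrow> bool"
    (infix "\<prec>\<^sub>s" 50) where
  "f \<prec>\<^sub>s g \<longleftrightarrow> f holomorphic_on ball 0 1 \<and> g holomorphic_on ball 0 1 \<and>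
     (\<exists>w. w holomorphic_on ball 0 1 \<and> w 0 = 0 \<and> (\<forall>z\<in>ball 0 1. norm (w z) \<le> norm z) \<and>
          (\<forall>z\<in>ball 0 1. f z = g (w z)))"

text \<open>
  This is \<open>S\<^sub>k(z) = z\<^sup>k f\<^sup>(\<^sup>k\<^sup>)(z) / f(z)\<close> with the removable singularity
  at \<open>0\<close> filled in by its limit. If \<open>f\<close> in \<open>class_A\<close> vanishes at some \<open>z \<noteq> 0\<close>, then
  \<open>S\<^sub>1\<close> has a pole there; it stays unbounded near \<open>z\<close>, so the value that
  \<open>remove_sings\<close> assigns at the pole itself cannot make \<open>S\<^sub>1\<close> holomorphic.
\<close>

definition S_quot :: "nat \<Rightarrow> (complex \<Rightarrow> complex) \<Rightarrow> complex \<Rightarrow> complex" where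
  "S_quot k f = remove_sings (\<lambda>z. z ^ k * (deriv ^^ k) f z / f z)"

text \<open>\<open>arsinh z = ln (z + (z\<^sup>2 + 1) powr (1/2))\<close>, with the principal branches on \<open>complex\<close>.\<close>

definition starlike_rho :: "(complex \<Rightarrow> complex) set" where
  "starlike_rho = {f \<in> class_A. S_quot 1 f \<prec>\<^sub>s (\<lambda>z. 1 + arsinh z)}"

definition S_op :: "real \<Rightarrow> real \<Rightarrow> (complex \<Rightarrow> complex) \<Rightarrow> complex \<Rightarrow> complex" where
  "S_op \<beta>1 \<beta>2 f z =
     (let S1 = S_quot 1 f z; S2 = S_quot 2 f z; S3 = S_quot 3 f z in
      1 + of_real \<beta>1 * (S2 - S1\<^sup>2 + S1)
        + of_real \<beta>2 * (S3 + 2 * S2 + 2 * S1 ^ 3 - 2 * S1\<^sup>2 - 3 * S1 * S2))"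

definition r0 :: real where
  "r0 = (THE r. 0 < r \<and> r\<^sup>2 + 2 * cot 1 * r - 1 = 0)"

lemma r0_ex1: "\<exists>!r::real. 0 < r \<and> r\<^sup>2 + 2 * cot 1 * r - 1 = 0"
proof -
  define c :: real where "c = cot 1"
  define s where "s = sqrt (c\<^sup>2 + 1) - c"
  have s: "0 < s" "s\<^sup>2 + 2 * c * s - 1 = 0"
  proof -
    have "\<bar>c\<bar> < sqrt (c\<^sup>2 + 1)"
      by (rule real_less_rsqrt) simp
    then show "0 < s"
      by (simp add: s_def)
    have "(s + c)\<^sup>2 = c\<^sup>2 + 1"
      by (simp add: s_def)
    then show "s\<^sup>2 + 2 * c * s - 1 = 0"
      by (simp add: power2_eq_square algebra_simps)
  qed
  have uniq: "r = s" if r: "0 < r" "r\<^sup>2 + 2 * c * r - 1 = 0" for r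
  proof -
    have "r * (r + 2 * c) = 1" "(r - s) * (r + s + 2 * c) = 0"
      using r s by (simp_all add: power2_eq_square algebra_simps)
    then have "0 < r + 2 * c"
      using r(1) by (metis zero_less_mult_pos zero_less_one)
    then show ?thesis
      using \<open>(r - s) * (r + s + 2 * c) = 0\<close> s(1) by auto
  qed
  show ?thesis
    unfolding c_def[symmetric] using s uniq by blast
qed

end

theory Submission
  imports Defs
begin

text \<open>
  Put \<open>p = z f'/f\<close>. Then \<open>S_f = 1 + \<beta>1 z p' + \<beta>2 z\<^sup>2 p''\<close>, and \<open>f\<close> has no zero in the
  punctured disc, since a zero would give \<open>S_f\<close> a pole of order three. Suppose that
  \<open>w = sinh (p - 1)\<close> leaves the unit disc, and let \<open>z\<close> be a point of smallest modulus with
  \<open>|w z| = 1\<close>. Jack's lemma gives \<open>z w' = m w\<close> and \<open>Re (1 + z w''/w') \<ge> m\<close> with \<open>m \<ge> 1\<close>,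
  hence \<open>|z p'| = m / sqrt |1 + w\<^sup>2| \<ge> 1 / sqrt 2\<close> and, because \<open>Re (w\<^sup>2 / (1 + w\<^sup>2)) = 1/2\<close> on the unit
  circle, \<open>Re (z p''/p') \<ge> m/2 - 1 \<ge> -1/2\<close>. So \<open>|S_f - 1| \<ge> (2 \<beta>1 - \<beta>2) / (2 sqrt 2)\<close> at that point,
  whereas in each of the eight cases \<open>|h - 1|\<close> stays below this bound on the open disc.
\<close>

section \<open>Jack's lemma\<close>

text \<open>A positive \<open>d\<close> would make \<open>\<phi>'\<close> positive just to the right
  of its zero \<open>a\<close>, so \<open>\<phi>\<close> would rise above its maximum there.\<close>

lemma deriv_at_global_max:
  fixes \<phi> \<phi>' :: "real \<Rightarrow> real"
  assumes d1: "\<And>t. (\<phi> has_real_derivative \<phi>' t) (at t)"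
    and d2: "(\<phi>' has_real_derivative d) (at a)"
    and max: "\<And>t. \<phi> t \<le> \<phi> a"
  shows "\<phi>' a = 0" "d \<le> 0"
proof -
  show 0: "\<phi>' a = 0"
    using DERIV_local_max[OF d1, of 1 a] max by auto
  show "d \<le> 0"
  proof (rule ccontr)
    assume "\<not> d \<le> 0"
    then obtain e where e: "e > 0" "\<And>h. 0 < h \<Longrightarrow> h < e \<Longrightarrow> 0 < \<phi>' (a + h)"
      using DERIV_pos_inc_right[OF d2] 0 by auto
    have "\<phi> a < \<phi> (a + e / 2)"
    proof (rule DERIV_pos_imp_increasing_open[of a "a + e / 2" \<phi>])
      show "a < a + e / 2" using e(1) by simp
      show "continuous_on {a..a + e / 2} \<phi>"
        using d1 by (meson DERIV_continuous_on has_field_derivative_at_within)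
      fix x assume "a < x" "x < a + e / 2"
      with e(1) have "0 < \<phi>' x"
        using e(2)[of "x - a"] by simp
      with d1 show "\<exists>y. (\<phi> has_real_derivative y) (at x) \<and> 0 < y" by blast
    qed
    with max[of "a + e / 2"] show False by simp
  qed
qed

lemma inner_mult_self: "z \<bullet> (c * z) = Re c * (norm z)\<^sup>2" for c z :: complex
  unfolding inner_complex_def cmod_power2 by (simp add: power2_eq_square algebra_simps)

text \<open>On the circle \<open>|z| = |z0|\<close> the function \<open>|w|^2\<close> is maximal at
  \<open>z0\<close>. Its first derivative in the angle makes \<open>z0 w'/w\<close> real, its second
  gives the bound on the real part, and the Schwarz lemma along the radius gives
  \<open>m \<ge> 1\<close>.\<close>

lemma Jack_lemma:
  fixes w :: "complex \<Rightarrow> complex" and z0 :: complex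
  assumes hol: "w holomorphic_on ball 0 R" and z0: "norm z0 < R" "z0 \<noteq> 0"
    and w0: "w 0 = 0" and wz0: "norm (w z0) = 1"
    and less: "\<And>z. norm z < norm z0 \<Longrightarrow> norm (w z) < 1"
  obtains m :: real where "m \<ge> 1" "z0 * deriv w z0 = of_real m * w z0"
    "Re (1 + z0 * deriv (deriv w) z0 / deriv w z0) \<ge> m"
proof -
  have dw: "(w has_field_derivative deriv w z) (at z)" if "norm z < R" for z
    using holomorphic_derivI[OF hol] that by simp
  have ddw: "(deriv w has_field_derivative deriv (deriv w) z) (at z)" if "norm z < R" for z
    using holomorphic_derivI[OF holomorphic_deriv[OF hol]] that by simp
  have le: "norm (w z) \<le> 1" if "norm z \<le> norm z0" for z
  proof (rule continuous_le_on_closure[of "ball 0 (norm z0)" "\<lambda>z. norm (w z)"])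
    show "continuous_on (closure (ball 0 (norm z0))) (\<lambda>z. norm (w z))"
      using z0 by (intro continuous_intros continuous_on_subset[OF holomorphic_on_imp_continuous_on[OF hol]])
        auto
  qed (use less that z0 in \<open>auto simp: less_imp_le\<close>)
  define \<gamma> where "\<gamma> t = z0 * exp (\<i> * of_real t)" for t
  have n\<gamma>: "norm (\<gamma> t) = norm z0" for t by (simp add: \<gamma>_def norm_mult)
  have \<gamma>0: "\<gamma> 0 = z0" by (simp add: \<gamma>_def)
  have d\<gamma>: "(\<gamma> has_vector_derivative \<i> * \<gamma> t) (at t)" for t
    unfolding \<gamma>_def by (auto intro!: derivative_eq_intros has_vector_derivative_real_field)
  define W where "W = w \<circ> \<gamma>"
  define W' where "W' t = \<i> * \<gamma> t * deriv w (\<gamma> t)" for t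
  \<comment> \<open>The second derivative of \<open>W\<close> is needed at \<open>0\<close> only;
    its sign comes from \<open>\<i>\<^sup>2\<close>.\<close>
  define W'' where "W'' = - (z0 * deriv w z0 + z0\<^sup>2 * deriv (deriv w) z0)"
  have dW: "(W has_vector_derivative W' t) (at t)" for t
    unfolding W_def W'_def using field_vector_diff_chain_at[OF d\<gamma> dw[of "\<gamma> t"]] z0 n\<gamma> by simp
  have dW': "(W' has_vector_derivative W'') (at 0)"
  proof -
    have "((deriv w \<circ> \<gamma>) has_vector_derivative \<i> * \<gamma> 0 * deriv (deriv w) (\<gamma> 0)) (at 0)"
      using field_vector_diff_chain_at[OF d\<gamma> ddw[of "\<gamma> 0"]] z0 n\<gamma> by simp
    from has_vector_derivative_mult[OF has_vector_derivative_mult_right[OF d\<gamma>, of \<i>] this]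
    show ?thesis
      unfolding W'_def W''_def o_def
      by (rule has_vector_derivative_eq_rhs) (simp add: \<gamma>0 algebra_simps power2_eq_square)
  qed
  have d1: "((\<lambda>t. W t \<bullet> W t) has_real_derivative 2 * (W t \<bullet> W' t)) (at t)" for t
    using bounded_bilinear.has_vector_derivative[OF bounded_bilinear_inner dW dW, of t]
    by (simp add: has_real_derivative_iff_has_vector_derivative inner_commute)
  have d2: "((\<lambda>t. 2 * (W t \<bullet> W' t)) has_real_derivative 2 * (W 0 \<bullet> W'' + W' 0 \<bullet> W' 0)) (at 0)"
    using has_vector_derivative_mult_right[OF bounded_bilinear.has_vector_derivative[OF bounded_bilinear_inner dW dW'], of 2]
    by (simp add: has_real_derivative_iff_has_vector_derivative)
  have max: "W t \<bullet> W t \<le> W 0 \<bullet> W 0" for t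
    using le[of "\<gamma> t"] n\<gamma>[of t] wz0 by (simp add: W_def \<gamma>0 dot_square_norm abs_square_le_1)
  note crit = deriv_at_global_max[OF d1 d2 max]
  define q where "q = z0 * deriv w z0 / w z0"
  define m where "m = Re q"
  have w0nz: "w z0 \<noteq> 0" using wz0 by auto
  have q: "z0 * deriv w z0 = q * w z0" using w0nz by (simp add: q_def)
  \<comment> \<open>Half the angular derivative of \<open>|w|^2\<close> at \<open>z0\<close> is
    \<open>- Im q\<close>, so criticality forces \<open>q\<close> to be real.\<close>
  have "w z0 \<bullet> (\<i> * (q * w z0)) = - Im q * (norm (w z0))\<^sup>2"
    using inner_mult_self[of "w z0" "\<i> * q"] by (simp add: mult.assoc)
  with crit(1) have "Im q = 0"
    using q by (simp add: W_def W'_def \<gamma>0 wz0 mult.assoc)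
  then have qm: "q = of_real m" by (simp add: complex_eq_iff m_def)
  \<comment> \<open>If \<open>m < 1\<close>, then \<open>|w (t z0)|^2 - t^2\<close>, which vanishes
    at \<open>t = 1\<close>, has negative slope \<open>2 m - 2\<close> there and so is positive just
    below \<open>1\<close>. This contradicts the Schwarz lemma for
    \<open>z \<mapsto> w (z0 z)\<close>, a self-map of the unit disc.\<close>
  have m1: "m \<ge> 1"
  proof (rule ccontr)
    assume "\<not> m \<ge> 1"
    define V where "V t = w (of_real t * z0)" for t :: real
    have "((\<lambda>t. of_real t * z0) has_vector_derivative z0) (at (1::real))"
      by (auto intro!: derivative_eq_intros)
    from field_vector_diff_chain_at[OF this, of w "deriv w z0"] dw[of z0] z0
    have dV: "(V has_vector_derivative q * w z0) (at 1)"
      by (simp add: V_def[abs_def] o_def q)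
    have "w z0 \<bullet> (q * w z0) = m * (norm (w z0))\<^sup>2"
      by (simp add: qm inner_mult_self)
    then have "((\<lambda>t. V t \<bullet> V t - t\<^sup>2) has_real_derivative 2 * m - 2) (at 1)"
      using bounded_bilinear.has_vector_derivative[OF bounded_bilinear_inner dV dV]
      by (auto intro!: derivative_eq_intros
          simp: has_real_derivative_iff_has_vector_derivative[symmetric] inner_commute V_def wz0)
    from DERIV_neg_dec_left[OF this] \<open>\<not> m \<ge> 1\<close>
    obtain d where d: "d > 0"
      "\<And>h. 0 < h \<Longrightarrow> h < d \<Longrightarrow> V 1 \<bullet> V 1 - 1\<^sup>2 < V (1 - h) \<bullet> V (1 - h) - (1 - h)\<^sup>2"
      by auto
    define h where "h = min (d / 2) (1 / 2)"
    have h: "0 < h" "h < d" "h < 1" using d(1) by (auto simp: h_def)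
    have "norm (w (z0 * of_real (1 - h))) \<le> norm (of_real (1 - h) :: complex)"
    proof (rule Schwarz_Lemma(1)[of "\<lambda>z. w (z0 * z)"])
      have "norm (z0 * z) < norm z0" if "norm z < 1" for z
        using that z0 by (simp add: norm_mult)
      then show "norm (w (z0 * z)) < 1" if "norm z < 1" for z
        using less that by blast
      have "norm (z0 * z) < R" if "norm z < 1" for z
        using \<open>\<And>z. norm z < 1 \<Longrightarrow> norm (z0 * z) < norm z0\<close>[OF that] z0(1) by linarith
      then show "(\<lambda>z. w (z0 * z)) holomorphic_on ball 0 1"
        by (intro holomorphic_on_compose_gen[OF _ hol, unfolded o_def] holomorphic_intros) auto
    qed (use w0 h in \<open>auto simp del: of_real_diff\<close>)
    then have "(norm (V (1 - h)))\<^sup>2 \<le> (1 - h)\<^sup>2"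
      using h by (intro power_mono) (auto simp: V_def mult.commute simp del: of_real_diff)
    with d(2)[OF h(1,2)] show False
      by (simp add: V_def wz0 dot_square_norm)
  qed
  have w'nz: "deriv w z0 \<noteq> 0" using q qm m1 w0nz z0 by auto
  define b where "b = 1 + z0 * deriv (deriv w) z0 / deriv w z0"
  have "W'' = - (b * (z0 * deriv w z0))"
    using w'nz by (simp add: W''_def b_def field_simps power2_eq_square)
  then have W'': "W'' = - (of_real m * b * w z0)" using q qm by simp
  \<comment> \<open>The second-order condition \<open>W \<bullet> W'' + |W'|^2 \<le> 0\<close> at
    \<open>0\<close> reads \<open>m^2 \<le> m * Re b\<close>.\<close>
  have "w z0 \<bullet> (of_real m * b * w z0) = m * Re b * (norm (w z0))\<^sup>2"
    by (simp add: inner_mult_self)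
  moreover have "W' 0 \<bullet> W' 0 = m\<^sup>2"
    by (simp add: W'_def \<gamma>0 mult.assoc q qm dot_square_norm norm_mult wz0 power_mult_distrib)
  ultimately have "m * m \<le> m * Re b"
    using crit(2) by (simp add: W_def \<gamma>0 W'' wz0 power2_eq_square)
  then have "m \<le> Re b" using m1 by simp
  with that m1 q qm show thesis unfolding b_def by simp
qed

section \<open>The differential inequality\<close>

text \<open>The Moebius map \<open>e / (1 + e)\<close> carries the unit circle to a vertical line,
  because \<open>|1 + e|^2 = 2 (1 + Re e)\<close> on the circle.\<close>

lemma Re_div_one_plus:
  assumes "norm e = 1" "1 + e \<noteq> 0"
  shows "Re (e / (1 + e)) = 1 / 2"
proof -
  have n: "(Re e)\<^sup>2 + (Im e)\<^sup>2 = 1" using assms(1) by (simp add: cmod_power2 flip: cmod_power2)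
  have "Re e \<noteq> -1" using n assms(2) by (auto simp: complex_eq_iff)
  moreover have "(1 + Re e)\<^sup>2 + (Im e)\<^sup>2 = 2 * (1 + Re e)"
    using n by (simp add: power2_eq_square algebra_simps)
  moreover have "Re e * (1 + Re e) + Im e * Im e = 1 + Re e"
    using n by (simp add: power2_eq_square algebra_simps)
  ultimately show ?thesis by (simp add: Re_divide)
qed

text \<open>Here \<open>u\<close> plays the role of \<open>p - 1\<close>. At the first point where
  \<open>|sinh u|\<close> reaches 1, the expression in \<open>less\<close> factors as
  \<open>z u'\<close> times \<open>\<beta>1 + \<beta>2 z u''/u'\<close>, with moduli at least
  \<open>1 / sqrt 2\<close> and \<open>(2 \<beta>1 - \<beta>2) / 2\<close>.\<close>

lemma norm_sinh_less_1:
  fixes u :: "complex \<Rightarrow> complex" and \<beta>1 \<beta>2 :: real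
  assumes hol: "u holomorphic_on ball 0 1" and u0: "u 0 = 0"
    and \<beta>: "\<beta>2 > 0" "2 * \<beta>1 - \<beta>2 > 0"
    and less: "\<And>z. norm z < 1 \<Longrightarrow> z \<noteq> 0 \<Longrightarrow>
      norm (of_real \<beta>1 * (z * deriv u z) + of_real \<beta>2 * (z\<^sup>2 * deriv (deriv u) z))
        < (2 * \<beta>1 - \<beta>2) / (2 * sqrt 2)"
    and z: "norm z < 1"
  shows "norm (sinh (u z)) < 1"
proof (rule ccontr)
  assume "\<not> norm (sinh (u z)) < 1"
  define w where "w = (\<lambda>z. sinh (u z))"
  have whol: "w holomorphic_on ball 0 1"
    unfolding w_def sinh_field_def by (intro holomorphic_intros hol) auto
  \<comment> \<open>\<open>K\<close> is compact and contains \<open>z\<close>, so it has a point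
    \<open>z0\<close> of least modulus; at smaller moduli \<open>|w| < 1\<close>.\<close>
  define K where "K = cball 0 (norm z) \<inter> (\<lambda>z. norm (w z)) -` {1..}"
  have "compact K"
  proof -
    have "continuous_on (cball 0 (norm z)) (\<lambda>z. norm (w z))"
      using z by (intro continuous_intros
          continuous_on_subset[OF holomorphic_on_imp_continuous_on[OF whol]]) auto
    then have "closed K"
      unfolding K_def by (intro continuous_closed_preimage) auto
    then show ?thesis
      unfolding compact_eq_bounded_closed by (auto simp: K_def)
  qed
  obtain z0 where "z0 \<in> K" and z0min: "\<And>y. y \<in> K \<Longrightarrow> norm z0 \<le> norm y"
    using continuous_attains_inf[OF \<open>compact K\<close> _ continuous_on_norm_id] \<open>\<not> norm (sinh (u z)) < 1\<close>
    by (fastforce simp: K_def w_def)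
  then have z0: "norm z0 < 1" "norm (w z0) \<ge> 1" "norm z0 \<le> norm z" using z by (auto simp: K_def)
  have "z0 \<noteq> 0" using z0(2) by (auto simp: w_def u0)
  have w_less: "norm (w y) < 1" if "norm y < norm z0" for y
    using z0min[of y] that z0(3) by (force simp: K_def)
  \<comment> \<open>A limit from the smaller disc; \<open>z0 \<noteq> 0\<close> makes the closure of
    that disc the closed disc through \<open>z0\<close>.\<close>
  have "norm (w z0) \<le> 1"
  proof (rule continuous_le_on_closure[of "ball 0 (norm z0)" "\<lambda>z. norm (w z)"])
    show "continuous_on (closure (ball 0 (norm z0))) (\<lambda>z. norm (w z))"
      using z0 \<open>z0 \<noteq> 0\<close>
      by (intro continuous_intros continuous_on_subset[OF holomorphic_on_imp_continuous_on[OF whol]])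
        auto
  qed (use w_less z0 \<open>z0 \<noteq> 0\<close> in \<open>auto simp: less_imp_le\<close>)
  with z0 have wz0: "norm (w z0) = 1" by simp
  obtain m where m: "m \<ge> 1" "z0 * deriv w z0 = of_real m * w z0"
    "Re (1 + z0 * deriv (deriv w) z0 / deriv w z0) \<ge> m"
    using Jack_lemma[OF whol z0(1) \<open>z0 \<noteq> 0\<close> _ wz0 w_less] by (auto simp: w_def u0)
  have du: "(u has_field_derivative deriv u y) (at y)" if "norm y < 1" for y
    using holomorphic_derivI[OF hol] that by simp
  have ddu: "(deriv u has_field_derivative deriv (deriv u) y) (at y)" if "norm y < 1" for y
    using holomorphic_derivI[OF holomorphic_deriv[OF hol]] that by simp
  have dw: "deriv w y = cosh (u y) * deriv u y" if "norm y < 1" for y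
    unfolding w_def by (rule DERIV_imp_deriv) (auto intro!: derivative_eq_intros du[OF that])
  define a c x y where "a = sinh (u z0)" and "c = cosh (u z0)" and "x = deriv u z0" and "y = deriv (deriv u) z0"
  have "deriv (deriv w) z0 = deriv (\<lambda>y. cosh (u y) * deriv u y) z0"
  proof (rule deriv_cong_ev)
    have "\<forall>\<^sub>F y in nhds z0. y \<in> ball 0 1"
      using z0(1) by (intro eventually_nhds_in_open) auto
    then show "\<forall>\<^sub>F y in nhds z0. deriv w y = cosh (u y) * deriv u y"
      by eventually_elim (simp add: dw)
  qed simp
  also have "\<dots> = a * x\<^sup>2 + c * y"
    unfolding a_def c_def x_def y_def
    by (rule DERIV_imp_deriv) (auto intro!: derivative_eq_intros du ddu z0 simp: power2_eq_square)
  finally have ddw: "deriv (deriv w) z0 = a * x\<^sup>2 + c * y" .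
  have m2: "z0 * (c * x) = of_real m * a"
    using m(2) dw[OF z0(1)] by (simp add: w_def a_def c_def x_def)
  have na: "norm a = 1" using wz0 by (simp add: a_def w_def)
  txt \<open>The singular values \<open>w z0 = \<plusminus>\<i>\<close> of the inverse of \<open>sinh\<close>, where \<open>c = 0\<close>, are excluded by \<open>m \<ge> 1\<close>.\<close>
  have nz: "c \<noteq> 0" "x \<noteq> 0" using m2 m(1) na by auto
  have cc: "c\<^sup>2 = 1 + a\<^sup>2" by (simp add: a_def c_def cosh_square_eq)
  have "(norm c)\<^sup>2 \<le> 2"
    using norm_triangle_ineq[of 1 "a\<^sup>2"] by (simp add: na norm_power flip: cc)
  then have "norm c \<le> sqrt 2" by (rule real_le_rsqrt)
  have "norm (z0 * x) * norm c = m"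
    using arg_cong[OF m2, of norm] m(1) by (simp add: norm_mult na mult_ac)
  then have "norm (z0 * x) = m / norm c" using nz by (simp add: field_simps)
  also have "\<dots> \<ge> 1 / sqrt 2"
    using \<open>norm c \<le> sqrt 2\<close> m(1) nz by (intro frac_le) auto
  finally have nzx: "norm (z0 * x) \<ge> 1 / sqrt 2" .
  define b where "b = 1 + z0 * (a * x\<^sup>2 + c * y) / (c * x)"
  have Reb: "Re b \<ge> m" using m(3) by (simp add: b_def ddw dw[OF z0(1)] c_def x_def)
  \<comment> \<open>By the definition of \<open>b\<close>,
    \<open>b - 1 = z0 a x / c + z0 y / x\<close>; the first summand is \<open>m a^2 / c^2\<close> by
    \<open>m2\<close>.\<close>
  have "z0 * y / x = b - 1 - (z0 * (c * x)) * a / c\<^sup>2"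
    using nz by (simp add: b_def field_simps power2_eq_square)
  then have "z0 * y / x = b - 1 - of_real m * (a\<^sup>2 / c\<^sup>2)"
    by (simp add: m2 power2_eq_square)
  then have zyx: "z0 * y / x = b - 1 - of_real m * (a\<^sup>2 / (1 + a\<^sup>2))"
    by (simp only: cc)
  have Re_mult: "Re (of_real r * e) = r * Re e" for r e by simp
  have "Re (a\<^sup>2 / (1 + a\<^sup>2)) = 1 / 2"
    using nz cc na by (intro Re_div_one_plus) (auto simp: norm_power simp flip: cc)
  then have "Re (z0 * y / x) = Re b - 1 - m * (1 / 2)"
    unfolding zyx minus_complex.simps Re_mult by simp
  also have "\<dots> \<ge> - (1 / 2)" using Reb m(1) by linarith
  finally have "Re (z0 * y / x) \<ge> - (1 / 2)" .
  then have "\<beta>2 * Re (z0 * y / x) \<ge> \<beta>2 * - (1 / 2)"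
    using \<beta>(1) by (intro mult_left_mono) auto
  then have "Re (of_real \<beta>1 + of_real \<beta>2 * (z0 * y / x)) \<ge> (2 * \<beta>1 - \<beta>2) / 2"
    by (simp only: plus_complex.simps Re_mult Re_complex_of_real) (simp add: field_simps)
  with complex_Re_le_cmod order_trans
  have "norm (of_real \<beta>1 + of_real \<beta>2 * (z0 * y / x)) \<ge> (2 * \<beta>1 - \<beta>2) / 2" by blast
  with nzx have "1 / sqrt 2 * ((2 * \<beta>1 - \<beta>2) / 2)
      \<le> norm (z0 * x) * norm (of_real \<beta>1 + of_real \<beta>2 * (z0 * y / x))"
    using \<beta>(2) by (intro mult_mono) auto
  also have "\<dots> = norm (of_real \<beta>1 * (z0 * x) + of_real \<beta>2 * (z0\<^sup>2 * y))"
    unfolding norm_mult[symmetric] using nz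
    by (intro arg_cong[of _ _ norm]) (simp add: field_simps power2_eq_square)
  also have "\<dots> < (2 * \<beta>1 - \<beta>2) / (2 * sqrt 2)"
    using less[OF z0(1) \<open>z0 \<noteq> 0\<close>] by (simp add: x_def y_def)
  finally show False by (simp add: field_simps)
qed

section \<open>The quotients \<open>S_quot\<close> and the operator \<open>S_op\<close>\<close>

text \<open>Dividing the series of \<open>f z - z\<close> by \<open>z^2\<close> gives a holomorphic
  \<open>h\<close> with \<open>f z = z * (1 + z * h z)\<close>, which splits off the simple zero at
  the origin.\<close>

lemma class_A_factor:
  assumes "f \<in> class_A"
  obtains g where "g holomorphic_on ball 0 1" "g 0 = 1" "\<And>z. norm z < 1 \<Longrightarrow> f z = z * g z"
proof -
  obtain a where a: "\<And>z. norm z < 1 \<Longrightarrow> (\<lambda>n. a (n + 2) * z ^ (n + 2)) sums (f z - z)"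
    using assms unfolding class_A_def mem_Collect_eq by (metis mem_ball_0)
  define h where "h z = (\<Sum>n. a (n + 2) * z ^ n)" for z
  have h: "(\<lambda>n. a (n + 2) * z ^ n) sums h z" if "norm z < 1" for z
  proof (cases "z = 0")
    case True
    then show ?thesis
      using powser_sums_zero[of "\<lambda>n. a (n + 2)"] by (simp add: h_def)
  next
    case False
    have "(\<lambda>n. a (n + 2) * z ^ (n + 2) / z\<^sup>2) sums ((f z - z) / z\<^sup>2)"
      by (rule sums_divide[OF a[OF that]])
    then have "(\<lambda>n. a (n + 2) * z ^ n) sums ((f z - z) / z\<^sup>2)"
      using False by (simp add: power2_eq_square)
    then show ?thesis unfolding h_def by (metis sums_unique)
  qed
  have "h holomorphic_on ball 0 1"
    by (rule power_series_holomorphic[where a = "\<lambda>n. a (n + 2)"]) (use h in auto)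
  then have "(\<lambda>z. 1 + z * h z) holomorphic_on ball 0 1"
    by (intro holomorphic_intros)
  moreover have "f z = z * (1 + z * h z)" if "norm z < 1" for z
  proof -
    have "(\<lambda>n. a (n + 2) * z ^ (n + 2)) sums (h z * z\<^sup>2)"
      using sums_mult2[OF h[OF that], of "z\<^sup>2"] by (simp add: power2_eq_square mult_ac)
    then have "f z - z = h z * z\<^sup>2"
      by (rule sums_unique2[OF a[OF that]])
    then show ?thesis by (simp add: algebra_simps power2_eq_square)
  qed
  ultimately show thesis using that[of "\<lambda>z. 1 + z * h z"] by simp
qed

lemma S_quot_nonzero:
  assumes "f analytic_on {z}" "f z \<noteq> 0"
  shows "S_quot k f z = z ^ k * (deriv ^^ k) f z / f z"
  unfolding S_quot_def using assms by (intro remove_sings_at_analytic analytic_intros) auto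

text \<open>The polynomials in \<open>S1\<close>, \<open>S2\<close>, \<open>S3\<close> that multiply
  \<open>\<beta>1\<close> and \<open>\<beta>2\<close> are the quotient-rule expansions of
  \<open>z p'\<close> and \<open>z^2 p''\<close>.\<close>

lemma S_op_eq:
  assumes "f holomorphic_on S" "open S" "z \<in> S" "f z \<noteq> 0"
  defines "p \<equiv> \<lambda>z. z * deriv f z / f z"
  shows "S_op \<beta>1 \<beta>2 f z = 1 + of_real \<beta>1 * (z * deriv p z) + of_real \<beta>2 * (z\<^sup>2 * deriv (deriv p) z)"
proof -
  define f1 f2 f3 where "f1 = deriv f" and "f2 = deriv f1" and "f3 = deriv f2"
  have hol: "f1 holomorphic_on S" "f2 holomorphic_on S"
    unfolding f1_def f2_def using assms by (auto intro!: holomorphic_deriv)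
  have d: "(f has_field_derivative f1 y) (at y)" "(f1 has_field_derivative f2 y) (at y)"
    "(f2 has_field_derivative f3 y) (at y)" if "y \<in> S" for y
    using holomorphic_derivI[OF assms(1) \<open>open S\<close> that] holomorphic_derivI[OF hol(1) \<open>open S\<close> that]
      holomorphic_derivI[OF hol(2) \<open>open S\<close> that] by (simp_all add: f1_def f2_def f3_def)
  define p1 where "p1 y = f1 y / f y + y * f2 y / f y - y * (f1 y)\<^sup>2 / (f y)\<^sup>2" for y
  have "(p has_field_derivative p1 y) (at y)" if "y \<in> S" "f y \<noteq> 0" for y
    unfolding p_def p1_def f1_def[symmetric] using that
    by (auto intro!: derivative_eq_intros d simp: field_simps power2_eq_square)
  then have p1: "deriv p y = p1 y" if "y \<in> S" "f y \<noteq> 0" for y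
    using that by (simp add: DERIV_imp_deriv)
  \<comment> \<open>The formula \<open>p1\<close> must hold in a neighbourhood of \<open>z\<close>,
    so that it can be differentiated again.\<close>
  have "open (S \<inter> f -` (- {0}))"
    using holomorphic_on_imp_continuous_on[OF assms(1)] \<open>open S\<close>
    by (intro continuous_open_preimage) auto
  then have "eventually (\<lambda>y. y \<in> S \<inter> f -` (- {0})) (nhds z)"
    using assms by (intro eventually_nhds_in_open) auto
  then have "eventually (\<lambda>y. deriv p y = p1 y) (nhds z)"
    by eventually_elim (simp add: p1)
  then have "deriv (deriv p) z = deriv p1 z" by (intro deriv_cong_ev) auto
  also have "\<dots> = 2 * f2 z / f z - 2 * (f1 z)\<^sup>2 / (f z)\<^sup>2 + z * f3 z / f z
      - 3 * z * f1 z * f2 z / (f z)\<^sup>2 + 2 * z * f1 z ^ 3 / f z ^ 3"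
    unfolding p1_def using assms(3,4)
    by (intro DERIV_imp_deriv)
      (auto intro!: derivative_eq_intros d simp: field_simps power2_eq_square power3_eq_cube)
  finally have p2: "deriv (deriv p) z = \<dots>" .
  have an: "f analytic_on {z}" using assms by (meson analytic_at)
  have S: "S_quot 1 f z = z * f1 z / f z" "S_quot 2 f z = z ^ 2 * f2 z / f z"
    "S_quot 3 f z = z ^ 3 * f3 z / f z"
    using S_quot_nonzero[OF an \<open>f z \<noteq> 0\<close>]
    by (simp_all add: f1_def f2_def f3_def numeral_eq_Suc)
  have e1: "S_quot 2 f z - (S_quot 1 f z)\<^sup>2 + S_quot 1 f z = z * p1 z"
    unfolding S p1_def using assms(4) by (simp add: field_simps power2_eq_square)
  have e2: "S_quot 3 f z + 2 * S_quot 2 f z + 2 * S_quot 1 f z ^ 3 - 2 * (S_quot 1 f z)\<^sup>2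
      - 3 * S_quot 1 f z * S_quot 2 f z = z\<^sup>2 * deriv (deriv p) z"
    unfolding S p2 using assms(4) by (simp add: field_simps power2_eq_square power3_eq_cube)
  show ?thesis
    unfolding S_op_def Let_def e1 e2 using p1 assms(3,4) by simp
qed

text \<open>At a zero \<open>z0\<close> of order \<open>n\<close> the quotient \<open>p\<close> has
  a simple pole with residue \<open>n * z0\<close>. Hence \<open>z^2 p''\<close> has a triple pole,
  which the at most double pole of \<open>z p'\<close> cannot cancel.\<close>

lemma S_op_holomorphic_imp_nonzero:
  assumes f: "f \<in> class_A" and hol: "S_op \<beta>1 \<beta>2 f holomorphic_on ball 0 1" and \<beta>2: "\<beta>2 \<noteq> 0"
    and z0: "norm z0 < 1" "z0 \<noteq> 0"
  shows "f z0 \<noteq> 0"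
proof
  assume fz0: "f z0 = 0"
  have fhol: "f holomorphic_on ball 0 1" using f by (simp add: class_A_def)
  obtain g where g: "g holomorphic_on ball 0 1" "g 0 = 1" "\<And>z. norm z < 1 \<Longrightarrow> f z = z * g z"
    by (rule class_A_factor[OF f]) (use that in blast)
  \<comment> \<open>A constant \<open>f\<close> would vanish identically, so \<open>g\<close> would
    vanish off the origin, against continuity and \<open>g 0 = 1\<close>.\<close>
  have "\<not> f constant_on ball 0 1"
  proof
    assume "f constant_on ball 0 1"
    then obtain c where c: "\<And>z. norm z < 1 \<Longrightarrow> f z = c" by (auto simp: constant_on_def)
    with z0 fz0 have "c = 0" by auto
    have "g z0 = 0" if "z0 \<in> ball 0 1 - {0}" for z0
      using that c[of z0] g(3)[of z0] \<open>c = 0\<close> by auto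
    then have "eventually (\<lambda>z. g z = 0) (at 0)"
      using eventually_at_ball'[of 1 0 UNIV] by (auto elim!: eventually_mono)
    then have "(g \<longlongrightarrow> 0) (at 0)" by (rule tendsto_eventually)
    moreover have "(g \<longlongrightarrow> 1) (at 0)"
      using holomorphic_on_imp_continuous_on[OF g(1)] g(2)
      by (metis centre_in_ball continuous_on_interior interior_ball isContD zero_less_one)
    ultimately show False using LIM_unique zero_neq_one by metis
  qed
  then obtain h r n where h: "0 < n" "0 < r" "ball z0 r \<subseteq> ball 0 1" "h holomorphic_on ball z0 r"
      "\<And>w. w \<in> ball z0 r \<Longrightarrow> f w = (w - z0) ^ n * h w" "\<And>w. w \<in> ball z0 r \<Longrightarrow> h w \<noteq> 0"
    using holomorphic_factor_zero_nonconstant[OF fhol open_ball connected_ball _ fz0] z0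
    by (metis mem_ball_0)
  \<comment> \<open>Since \<open>n w / (w - z0) = n z0 / (w - z0) + n\<close>, the summand
    \<open>n\<close> belongs to the regular part \<open>G\<close>, and the residue is
    \<open>N\<close> below.\<close>
  define G where "G z = of_nat n + z * deriv h z / h z" for z
  have Ghol: "G holomorphic_on ball z0 r"
    unfolding G_def using h by (intro holomorphic_intros) auto
  define N where "N = of_nat n * z0"
  define p where "p = (\<lambda>z. z * deriv f z / f z)"
  have pol: "p w = N / (w - z0) + G w" if w: "w \<in> ball z0 r - {z0}" for w
  proof -
    have "(h has_field_derivative deriv h w) (at w)"
      using holomorphic_derivI[OF h(4)] w by simp
    then have "((\<lambda>w. (w - z0) ^ n * h w) has_field_derivative
        of_nat n * (w - z0) ^ (n - 1) * h w + (w - z0) ^ n * deriv h w) (at w)"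
      by (auto intro!: derivative_eq_intros)
    moreover have "eventually (\<lambda>w. w \<in> ball z0 r) (nhds w)"
      using w by (intro eventually_nhds_in_open) auto
    then have "eventually (\<lambda>w. f w = (w - z0) ^ n * h w) (nhds w)"
      by eventually_elim (simp add: h(5))
    ultimately have "deriv f w = of_nat n * (w - z0) ^ (n - 1) * h w + (w - z0) ^ n * deriv h w"
      using DERIV_imp_deriv deriv_cong_ev by metis
    moreover define d P where "d = w - z0" and "P = (w - z0) ^ (n - 1)"
    ultimately have "deriv f w = of_nat n * P * h w + d * P * deriv h w"
      using \<open>0 < n\<close> by (simp add: power_eq_if)
    moreover have "f w = d * P * h w"
      using h(1,5) w by (simp add: d_def P_def power_eq_if)
    moreover have nz: "d \<noteq> 0" "P \<noteq> 0" "h w \<noteq> 0" using w h(6) by (auto simp: d_def P_def)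
    ultimately have "p w = of_nat n * w / d + w * deriv h w / h w"
      by (simp add: p_def field_simps)
    also have "of_nat n * w / d = N / d + of_nat n"
      using nz by (simp add: N_def d_def field_simps)
    finally show ?thesis by (simp add: G_def d_def)
  qed
  have nz: "f w \<noteq> 0" if "w \<in> ball z0 r - {z0}" for w using that h(5,6)[of w] by simp
  have dG: "(G has_field_derivative deriv G w) (at w)"
    "(deriv G has_field_derivative deriv (deriv G) w) (at w)" if "w \<in> ball z0 r" for w
    using holomorphic_derivI[OF Ghol] holomorphic_derivI[OF holomorphic_deriv[OF Ghol]] that by auto
  have ev: "eventually (\<lambda>w. w \<in> ball z0 r - {z0}) (nhds w)" if "w \<in> ball z0 r - {z0}" for w
    using that by (intro eventually_nhds_in_open) auto
  have dp: "deriv p w = - N / (w - z0)\<^sup>2 + deriv G w" if w: "w \<in> ball z0 r - {z0}" for w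
  proof -
    have "deriv p w = deriv (\<lambda>w. N / (w - z0) + G w) w"
      by (rule deriv_cong_ev[OF _ refl]) (use ev[OF w] in \<open>eventually_elim, simp add: pol\<close>)
    also have "\<dots> = - N / (w - z0)\<^sup>2 + deriv G w"
      using w by (intro DERIV_imp_deriv) (auto intro!: derivative_eq_intros dG simp: power2_eq_square)
    finally show ?thesis .
  qed
  have ddp: "deriv (deriv p) w = 2 * N / (w - z0) ^ 3 + deriv (deriv G) w" if w: "w \<in> ball z0 r - {z0}" for w
  proof -
    have "deriv (deriv p) w = deriv (\<lambda>w. - N / (w - z0)\<^sup>2 + deriv G w) w"
      by (rule deriv_cong_ev[OF _ refl]) (use ev[OF w] in \<open>eventually_elim, simp add: dp\<close>)
    also have "\<dots> = N * (2 * (w - z0)) / ((w - z0)\<^sup>2 * (w - z0)\<^sup>2) + deriv (deriv G) w"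
      using w by (intro DERIV_imp_deriv) (auto intro!: derivative_eq_intros dG)
    also have "N * (2 * d) / (d\<^sup>2 * d\<^sup>2) = 2 * N / d ^ 3" for d
      by (cases "d = 0") (simp_all add: power2_eq_square power3_eq_cube field_simps)
    finally show ?thesis .
  qed
  \<comment> \<open>\<open>R\<close> is \<open>(w - z0)^3 (S_op - 1)\<close> with denominators
    cleared. It is continuous at \<open>z0\<close> with value
    \<open>2 \<beta>2 z0^2 N \<noteq> 0\<close>, whereas continuity of \<open>S_op\<close> forces
    the limit \<open>0\<close>.\<close>
  define R where "R w = of_real \<beta>1 * w * (- N * (w - z0) + deriv G w * (w - z0) ^ 3)
    + of_real \<beta>2 * w\<^sup>2 * (2 * N + deriv (deriv G) w * (w - z0) ^ 3)" for w
  have eq: "(w - z0) ^ 3 * (S_op \<beta>1 \<beta>2 f w - 1) = R w" if w: "w \<in> ball z0 r - {z0}" for w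
  proof -
    have "S_op \<beta>1 \<beta>2 f w - 1 = of_real \<beta>1 * (w * deriv p w) + of_real \<beta>2 * (w\<^sup>2 * deriv (deriv p) w)"
      unfolding p_def using S_op_eq[OF fhol open_ball _ nz[OF w]] w h(3) by auto
    moreover have "d ^ 3 * (a * (w * (- N / d\<^sup>2 + x)) + c * (w\<^sup>2 * (2 * N / d ^ 3 + y)))
        = a * w * (- N * d + x * d ^ 3) + c * w\<^sup>2 * (2 * N + y * d ^ 3)" if "d \<noteq> 0" for a c d x y
      using that by (simp add: field_simps power2_eq_square power3_eq_cube)
    ultimately show ?thesis
      using w by (simp add: dp ddp R_def)
  qed
  have "isCont (deriv G) z0" "isCont (deriv (deriv G)) z0"
    using dG(2)[of z0] holomorphic_on_imp_continuous_on[OF holomorphic_deriv[OF holomorphic_deriv[OF Ghol]]] h(2)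
    by (auto simp: DERIV_isCont continuous_on_eq_continuous_at)
  then have "isCont R z0" unfolding R_def by (intro continuous_intros) auto
  then have 1: "(R \<longlongrightarrow> of_real \<beta>2 * z0\<^sup>2 * (2 * N)) (at z0)"
    by (simp add: isCont_def R_def)
  have "isCont (S_op \<beta>1 \<beta>2 f) z0"
    using holomorphic_on_imp_continuous_on[OF hol] z0 by (simp add: continuous_on_eq_continuous_at)
  then have "isCont (\<lambda>w. (w - z0) ^ 3 * (S_op \<beta>1 \<beta>2 f w - 1)) z0" by (intro continuous_intros)
  then have 2: "((\<lambda>w. (w - z0) ^ 3 * (S_op \<beta>1 \<beta>2 f w - 1)) \<longlongrightarrow> 0) (at z0)"
    by (simp add: isCont_def)
  have "eventually (\<lambda>w. w \<in> ball z0 r - {z0}) (at z0)"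
    using h(2) by (auto simp: eventually_at dist_commute)
  then have "eventually (\<lambda>w. (w - z0) ^ 3 * (S_op \<beta>1 \<beta>2 f w - 1) = R w) (at z0)"
    by eventually_elim (rule eq)
  from tendsto_cong[OF this] 2 have "(R \<longlongrightarrow> 0) (at z0)" by simp
  with 1 have "of_real \<beta>2 * z0\<^sup>2 * (2 * N) = 0" by (rule LIM_unique)
  then show False using \<beta>2 z0 h(1) by (simp add: N_def)
qed

text \<open>Writing \<open>f z = z * g z\<close> with \<open>g\<close> free of zeros gives
  \<open>z f'/f = 1 + z g'/g\<close>, and the right side is regular at the origin.\<close>

lemma S_quot_1_holomorphic:
  assumes f: "f \<in> class_A" and nz: "\<And>z. norm z < 1 \<Longrightarrow> z \<noteq> 0 \<Longrightarrow> f z \<noteq> 0"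
  shows "S_quot 1 f holomorphic_on ball 0 1" "S_quot 1 f 0 = 1"
proof -
  obtain g where g: "g holomorphic_on ball 0 1" "g 0 = 1" "\<And>z. norm z < 1 \<Longrightarrow> f z = z * g z"
    by (rule class_A_factor[OF f]) (use that in blast)
  have gnz: "g z \<noteq> 0" if "norm z < 1" for z
    using nz[OF that] g(2) g(3)[OF that] by (cases "z = 0") auto
  define q where "q z = 1 + z * deriv g z / g z" for z
  have qhol: "q holomorphic_on ball 0 1"
    unfolding q_def using g gnz by (intro holomorphic_intros) auto
  have eq: "z * deriv f z / f z = q z" if z: "norm z < 1" "z \<noteq> 0" for z
  proof -
    have "eventually (\<lambda>w. w \<in> ball 0 1) (nhds z)"
      using z by (intro eventually_nhds_in_open) auto
    then have "eventually (\<lambda>w. f w = w * g w) (nhds z)"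
      by eventually_elim (simp add: g(3))
    then have "deriv f z = deriv (\<lambda>w. w * g w) z" by (rule deriv_cong_ev) simp
    also have "\<dots> = g z + z * deriv g z"
      using holomorphic_derivI[OF g(1) open_ball, of z] z
      by (intro DERIV_imp_deriv) (auto intro!: derivative_eq_intros)
    finally show ?thesis using z gnz[OF z(1)] by (simp add: q_def g(3) field_simps)
  qed
  have Sq: "S_quot 1 f z = q z" if z: "norm z < 1" for z
  proof -
    have "eventually (\<lambda>w. w \<in> ball 0 1 - {0}) (at z)"
    proof -
      have "eventually (\<lambda>w. w \<in> ball 0 1) (at z)"
        using z by (intro eventually_at_in_open') auto
      moreover have "eventually (\<lambda>w. w \<noteq> 0) (at z)"
        by (cases "z = 0") (auto simp: eventually_neq_at_within)
      ultimately show ?thesis by eventually_elim simp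
    qed
    then have "eventually (\<lambda>w. w ^ 1 * (deriv ^^ 1) f w / f w = q w) (at z)"
      by eventually_elim (simp add: eq)
    \<comment> \<open>\<open>remove_sings\<close> depends only on a punctured neighbourhood, so the
      same argument covers \<open>z = 0\<close>.\<close>
    then have "S_quot 1 f z = remove_sings q z"
      unfolding S_quot_def by (rule remove_sings_cong) simp
    also have "\<dots> = q z"
      using qhol z by (intro remove_sings_at_analytic) (auto simp: analytic_at intro!: exI[of _ "ball 0 1"])
    finally show ?thesis .
  qed
  show "S_quot 1 f 0 = 1" by (simp add: Sq q_def del: One_nat_def)
  show "S_quot 1 f holomorphic_on ball 0 1"
    using qhol by (rule holomorphic_transform) (simp add: Sq del: One_nat_def)
qed

text \<open>Transfers \<open>S_op_eq\<close> from the raw quotient to \<open>S_quot 1 f\<close>. The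
  two agree near every nonzero point; at \<open>0\<close> the raw quotient is \<open>0\<close> by
  the convention on division instead of \<open>1\<close>, hence \<open>z \<noteq> 0\<close>.\<close>

lemma S_op_eq_S_quot_1:
  assumes f: "f \<in> class_A" and nz: "\<And>z. norm z < 1 \<Longrightarrow> z \<noteq> 0 \<Longrightarrow> f z \<noteq> 0"
    and z: "norm z < 1" "z \<noteq> 0"
  shows "S_op \<beta>1 \<beta>2 f z = 1 + of_real \<beta>1 * (z * deriv (S_quot 1 f) z)
    + of_real \<beta>2 * (z\<^sup>2 * deriv (deriv (S_quot 1 f)) z)"
proof -
  have fhol: "f holomorphic_on ball 0 1" using f by (simp add: class_A_def)
  define p where "p = (\<lambda>z. z * deriv f z / f z)"
  have Sp: "S_quot 1 f w = p w" if "w \<in> ball 0 1 - {0}" for w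
  proof -
    have "f analytic_on {w}" using fhol that by (auto simp: analytic_at intro!: exI[of _ "ball 0 1"])
    then show ?thesis using S_quot_nonzero[of f w 1] nz[of w] that by (simp add: p_def)
  qed
  have ev: "eventually (\<lambda>w. w \<in> ball 0 1 - {0}) (nhds w)" if "w \<in> ball 0 1 - {0}" for w :: complex
    using that by (intro eventually_nhds_in_open) auto
  have d1: "deriv (S_quot 1 f) w = deriv p w" if "w \<in> ball 0 1 - {0}" for w
    by (rule deriv_cong_ev[OF _ refl]) (rule eventually_mono[OF ev[OF that] Sp])
  have d2: "deriv (deriv (S_quot 1 f)) w = deriv (deriv p) w" if "w \<in> ball 0 1 - {0}" for w
    by (rule deriv_cong_ev[OF _ refl]) (rule eventually_mono[OF ev[OF that] d1])
  show ?thesis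
    using S_op_eq[OF fhol open_ball _ nz[OF z], of \<beta>1 \<beta>2, folded p_def] z
    by (simp add: d1 d2 del: One_nat_def)
qed

section \<open>Bounds for elementary functions on the unit disc\<close>

text \<open>Termwise comparison: the Taylor coefficients of \<open>sinh\<close> are the absolute
  values of those of \<open>sin\<close>.\<close>

lemma norm_sin_le_sinh: "norm (sin z) \<le> sinh (norm z)" for z :: complex
proof -
  have s: "(\<lambda>n. if even n then 0 else norm z ^ n /\<^sub>R fact n) sums sinh (norm z)"
    by (rule sinh_converges)
  have n: "norm (sin_coeff n *\<^sub>R z ^ n) \<le> (if even n then 0 else norm z ^ n /\<^sub>R fact n)" for n
    by (simp add: sin_coeff_def norm_power norm_mult abs_mult power_abs divide_inverse)
  show ?thesis
    using norm_sums_le[OF sin_converges s n] .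
qed

lemma norm_exp_minus_1_le: "norm (exp z - 1) \<le> exp (norm z) - 1" for z :: complex
proof -
  have "(\<lambda>n. z ^ Suc n /\<^sub>R fact (Suc n)) sums (exp z - 1)"
    using exp_converges[of z] by (subst sums_Suc_iff) simp
  moreover have "(\<lambda>n. norm z ^ Suc n /\<^sub>R fact (Suc n)) sums (exp (norm z) - 1)"
    using exp_converges[of "norm z"] by (subst sums_Suc_iff) simp
  ultimately show ?thesis
    by (rule norm_sums_le) (simp add: norm_power norm_mult)
qed

text \<open>Yields \<open>|sinh| \<ge> 1\<close> on the lines
  \<open>Im z = \<plusminus> pi/2\<close>, which bound the strip where \<open>arsinh\<close> inverts
  \<open>sinh\<close>.\<close>

lemma norm_sinh_squared: "(norm (sinh z))\<^sup>2 = (sinh (Re z))\<^sup>2 + (sin (Im z))\<^sup>2" for z :: complex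
proof -
  have "sinh z = Complex (sinh (Re z) * cos (Im z)) (cosh (Re z) * sin (Im z))"
    by (simp add: complex_eq_iff sinh_field_def cosh_field_def Re_exp Im_exp field_simps)
  then have "(norm (sinh z))\<^sup>2 = (sinh (Re z))\<^sup>2 * (cos (Im z))\<^sup>2 + (cosh (Re z))\<^sup>2 * (sin (Im z))\<^sup>2"
    by (simp add: cmod_power2 power_mult_distrib)
  also have "\<dots> = (sinh (Re z))\<^sup>2 + (sin (Im z))\<^sup>2"
    by (simp add: cosh_square_eq cos_squared_eq algebra_simps)
  finally show ?thesis .
qed

lemma abs_le_abs_sinh: "\<bar>x\<bar> \<le> \<bar>sinh x\<bar>" for x :: real
  using real_le_abs_sinh[of x] by (simp add: sinh_field_def exp_minus)

text \<open>With \<open>b = |Im u|\<close>, the assumption \<open>|u| \<ge> pi/2\<close> would give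
  \<open>(Re u)^2 \<ge> (pi/2)^2 - b^2 \<ge> (pi/2 - b)^2 \<ge> (cos b)^2\<close>. As
  \<open>|sinh (Re u)| \<ge> |Re u|\<close>, it would follow that
  \<open>|sinh u|^2 \<ge> (cos b)^2 + (sin b)^2 = 1\<close>.\<close>

lemma norm_less_pi_half:
  fixes u :: complex
  assumes "\<bar>Im u\<bar> \<le> pi / 2" "norm (sinh u) < 1"
  shows "norm u < pi / 2"
proof (rule ccontr)
  assume "\<not> norm u < pi / 2"
  define b where "b = \<bar>Im u\<bar>"
  have b: "0 \<le> b" "b \<le> pi / 2" using assms by (auto simp: b_def)
  have "(pi / 2)\<^sup>2 \<le> (norm u)\<^sup>2" using \<open>\<not> norm u < pi / 2\<close> by (intro power_mono) auto
  then have "(pi / 2)\<^sup>2 - b\<^sup>2 \<le> (Re u)\<^sup>2" by (simp add: cmod_power2 b_def)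
  moreover have "(pi / 2 - b)\<^sup>2 \<le> (pi / 2)\<^sup>2 - b\<^sup>2"
    using mult_right_mono[of b "pi / 2" b] b by (simp add: power2_eq_square algebra_simps)
  moreover have "(cos b)\<^sup>2 \<le> (pi / 2 - b)\<^sup>2"
    using abs_sin_x_le_abs_x[of "pi / 2 - b"] by (simp add: sin_diff abs_le_square_iff)
  moreover have "(Re u)\<^sup>2 \<le> (sinh (Re u))\<^sup>2"
    using abs_le_abs_sinh[of "Re u"] by (simp add: abs_le_square_iff)
  moreover have "(sin b)\<^sup>2 = (sin (Im u))\<^sup>2" by (simp add: b_def abs_if)
  ultimately have "1 \<le> (norm (sinh u))\<^sup>2"
    using sin_cos_squared_add[of b] unfolding norm_sinh_squared by linarith
  moreover have "(norm (sinh u))\<^sup>2 < 1" using assms(2) by (simp add: abs_square_less_1)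
  ultimately show False by simp
qed

section \<open>The principal inverse hyperbolic sine on the unit disc\<close>

lemma one_plus_square_not_nonpos:
  "norm z < 1 \<Longrightarrow> 1 + z\<^sup>2 \<notin> \<real>\<^sub>\<le>\<^sub>0" for z :: complex
proof -
  assume "norm z < 1"
  then have "norm (z\<^sup>2) < 1" by (simp add: norm_power power_less_one_iff abs_square_less_1)
  then have "Re (1 + z\<^sup>2) > 0" using complex_Re_le_cmod[of "- z\<^sup>2"] by simp
  then show ?thesis using complex_nonpos_Reals_iff by auto
qed

lemma arsinh_csqrt: "arsinh z = Ln (z + csqrt (1 + z\<^sup>2))"
proof -
  have "(z\<^sup>2 + 1) powr of_real (1 / 2) = csqrt (1 + z\<^sup>2)"
    by (cases "1 + z\<^sup>2 = 0") (simp_all add: csqrt_conv_powr add.commute)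
  then show ?thesis by (simp add: arsinh_def)
qed

text \<open>Real parts in \<open>v^2 = 1 + z^2\<close> give \<open>(Re v)^2 > (Re z)^2\<close>
  because \<open>|Im z| < 1\<close>. The conclusion keeps the logarithm in \<open>arsinh\<close> off
  its branch cut and its imaginary part within \<open>pi / 2\<close>.\<close>

lemma add_csqrt_Re_pos:
  assumes "norm z < 1"
  shows "Re (z + csqrt (1 + z\<^sup>2)) > 0"
proof -
  define v where "v = csqrt (1 + z\<^sup>2)"
  have v2: "v\<^sup>2 = 1 + z\<^sup>2" by (simp add: v_def)
  have Rv: "Re v \<ge> 0" using csqrt_principal[of "1 + z\<^sup>2"] by (auto simp: v_def)
  have "(Re v)\<^sup>2 - (Im v)\<^sup>2 = 1 + (Re z)\<^sup>2 - (Im z)\<^sup>2"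
    using arg_cong[OF v2, of Re] by (simp add: Re_power2)
  moreover have "(Re z)\<^sup>2 + (Im z)\<^sup>2 < 1"
    using assms by (simp add: cmod_def)
  ultimately have "(Re z)\<^sup>2 < (Re v)\<^sup>2"
    using zero_le_power2[of "Im v"] zero_le_power2[of "Re z"] by linarith
  then have "- Re z < Re v"
    by (intro power2_less_imp_less[of "- Re z"]) (use Rv in auto)
  then show ?thesis by (simp add: v_def)
qed

lemma holomorphic_on_arsinh: "arsinh holomorphic_on ball (0::complex) 1"
proof -
  have "z + csqrt (1 + z\<^sup>2) \<notin> \<real>\<^sub>\<le>\<^sub>0" if "norm z < 1" for z
    using add_csqrt_Re_pos[OF that] complex_nonpos_Reals_iff by auto
  then show ?thesis
    unfolding arsinh_csqrt[abs_def]
    by (intro holomorphic_intros) (auto dest: one_plus_square_not_nonpos)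
qed

text \<open>\<open>v - z\<close> is the inverse of \<open>z + v = exp (arsinh z)\<close>, and half
  the difference of the two is \<open>z\<close>.\<close>

lemma sinh_arsinh_complex: "sinh (arsinh z) = z" for z :: complex
proof -
  define v where "v = csqrt (1 + z\<^sup>2)"
  have v2: "v\<^sup>2 = 1 + z\<^sup>2" by (simp add: v_def)
  then have "(v + z) * (v - z) = 1" by (simp add: power2_eq_square algebra_simps)
  then have "z + v \<noteq> 0" "inverse (z + v) = v - z"
    by (auto simp: add.commute inverse_unique)
  then show ?thesis
    by (simp add: arsinh_csqrt flip: v_def) (simp add: sinh_field_def exp_minus)
qed

lemma Im_arsinh_less: "norm z < 1 \<Longrightarrow> \<bar>Im (arsinh z)\<bar> < pi / 2"
  unfolding arsinh_csqrt using add_csqrt_Re_pos[of z]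
  by (intro Re_Ln_pos_lt_imp) auto

text \<open>In this strip \<open>Re (cosh u) > 0\<close>, so the principal root of
  \<open>1 + (sinh u)^2\<close> is \<open>cosh u\<close>, and \<open>Ln\<close> undoes
  \<open>exp u = sinh u + cosh u\<close>.\<close>

lemma arsinh_sinh_complex:
  fixes u :: complex
  assumes "\<bar>Im u\<bar> < pi / 2"
  shows "arsinh (sinh u) = u"
proof -
  have "cosh u = Complex (cosh (Re u) * cos (Im u)) (sinh (Re u) * sin (Im u))"
    by (simp add: complex_eq_iff sinh_field_def cosh_field_def Re_exp Im_exp field_simps)
  moreover have "cos (Im u) > 0" using assms by (intro cos_gt_zero_pi) auto
  ultimately have "Re (cosh u) > 0" by simp
  then have "csqrt ((cosh u)\<^sup>2) = cosh u" by (intro csqrt_square) auto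
  then have "csqrt (1 + (sinh u)\<^sup>2) = cosh u" by (simp add: cosh_square_eq add.commute)
  then have "arsinh (sinh u) = Ln (exp u)" by (simp add: arsinh_csqrt sinh_plus_cosh)
  also have "\<dots> = u" using assms by (intro Ln_exp) auto
  finally show ?thesis .
qed

lemma norm_arsinh_less: "norm z < 1 \<Longrightarrow> norm (arsinh z) < pi / 2" for z :: complex
  using norm_less_pi_half[of "arsinh z"] Im_arsinh_less[of z] by (simp add: sinh_arsinh_complex)

text \<open>In the factorisation \<open>(v - 1) (v + 1) = z\<close> the principal root has
  \<open>Re v \<ge> 0\<close>, so \<open>|v + 1| \<ge> 1\<close>.\<close>

lemma norm_csqrt_minus_1_le:
  "norm (csqrt (1 + z) - 1) \<le> norm z"
proof -
  define v where "v = csqrt (1 + z)"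
  have v: "(v - 1) * (v + 1) = z"
    using power2_csqrt[of "1 + z"] by (simp add: v_def power2_eq_square algebra_simps)
  have "Re v \<ge> 0" using csqrt_principal[of "1 + z"] by (auto simp: v_def)
  then have "1 \<le> norm (v + 1)" using complex_Re_le_cmod[of "v + 1"] by simp
  then have "norm (v - 1) * 1 \<le> norm (v - 1) * norm (v + 1)" by (intro mult_left_mono) auto
  also have "\<dots> = norm z" using v by (simp flip: norm_mult)
  finally show ?thesis by (simp add: v_def)
qed

lemma norm_crescent_minus_1_less:
  assumes "norm z < 1"
  shows "norm (z + csqrt (1 + z\<^sup>2) - 1) < sqrt 2"
proof -
  define v where "v = z + csqrt (1 + z\<^sup>2)"
  have Rv: "Re v > 0" using add_csqrt_Re_pos[OF assms] by (simp add: v_def)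
  have "(v - z)\<^sup>2 = 1 + z\<^sup>2" by (simp add: v_def)
  \<comment> \<open>The root equation turns \<open>|z| < 1\<close> into the region
    \<open>|v^2 - 1| < 2 |v|\<close>.\<close>
  then have "(v - 1) * (v + 1) = 2 * v * z" by (simp add: power2_eq_square algebra_simps)
  then have "norm (v - 1) * norm (v + 1) = 2 * norm v * norm z" by (metis norm_mult norm_numeral)
  also have "\<dots> < 2 * norm v" using assms Rv by (cases "v = 0") auto
  finally have lt: "norm (v - 1) * norm (v + 1) < 2 * norm v" .
  txt \<open>\<open>|v\<^sup>2 - 1| = 2 |v|\<close> is the union of the circles of radius \<open>sqrt 2\<close> about \<open>\<plusminus>1\<close>.\<close>
  have n1: "(norm (v - 1))\<^sup>2 = (norm v)\<^sup>2 + 1 - 2 * Re v"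
    "(norm (v + 1))\<^sup>2 = (norm v)\<^sup>2 + 1 + 2 * Re v"
    unfolding cmod_power2 by (simp_all add: power2_eq_square algebra_simps)
  have "(norm (v - 1) * norm (v + 1))\<^sup>2 < (2 * norm v)\<^sup>2"
    using lt by (intro power_strict_mono) auto
  then have "(norm (v - 1))\<^sup>2 * (norm (v + 1))\<^sup>2 < 4 * (norm v)\<^sup>2"
    by (simp add: power_mult_distrib)
  then have "((norm v)\<^sup>2 - 1)\<^sup>2 < (2 * Re v)\<^sup>2"
    unfolding n1 by (simp add: power2_eq_square algebra_simps)
  \<comment> \<open>Taking the root with \<open>Re v > 0\<close> selects the disc about
    \<open>1\<close>, since \<open>|v - 1|^2 = |v|^2 + 1 - 2 Re v\<close>.\<close>
  then have "(norm v)\<^sup>2 - 1 < 2 * Re v"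
    by (rule power2_less_imp_less) (use Rv in simp)
  then have "(norm (v - 1))\<^sup>2 < 2"
    using n1 by simp
  then show ?thesis unfolding v_def[symmetric] by (rule real_less_rsqrt)
qed

section \<open>The modified sigmoid function and \<open>r0\<close>\<close>

text \<open>For \<open>t = tan (1/2)\<close> the double-angle formulas give
  \<open>2 * cot 1 * t = 1 - t^2\<close>; \<open>r0_ex1\<close> supplies uniqueness.\<close>

lemma r0_eq_tan: "r0 = tan (1 / 2)"
proof -
  have p: "0 < (1 / 2 :: real)" "1 / 2 < pi / 2" using pi_gt3 by auto
  have t: "tan (1 / 2) > (0::real)" using tan_gt_zero[OF p] .
  have c: "cos (1 / 2) > (0::real)" using cos_gt_zero[OF p] .
  have s: "sin (1 / 2) > (0::real)" using p by (intro sin_gt_zero2)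
  have "cot 1 = cos (2 * (1/2)) / sin (2 * (1/2) :: real)" by (simp add: cot_def)
  also have "\<dots> = ((cos (1/2))\<^sup>2 - (sin (1/2))\<^sup>2) / (2 * sin (1/2) * cos (1/2))"
    by (simp only: cos_double sin_double)
  finally have "(tan (1/2))\<^sup>2 + 2 * cot 1 * tan (1/2) - 1 = (0::real)"
    using c s by (simp add: tan_def field_simps power2_eq_square)
  with t show ?thesis
    unfolding r0_def using r0_ex1 by (intro the1_equality) auto
qed

text \<open>The difference has derivative \<open>t * sin t \<ge> 0\<close>. Together with
  \<open>sinh_le_mult_cosh\<close> this fixes the sign of the angular derivative in
  \<open>cosh_mult_cos_norm_le\<close>.\<close>

lemma mult_cos_le_sin: "x * cos x \<le> sin x" if "0 \<le> x" "x \<le> pi" for x :: real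
proof -
  have "(\<lambda>t. sin t - t * cos t) 0 \<le> sin x - x * cos x"
  proof (rule DERIV_nonneg_imp_nondecreasing[OF \<open>0 \<le> x\<close>])
    fix t assume "0 \<le> t" "t \<le> x"
    have "((\<lambda>t. sin t - t * cos t) has_real_derivative t * sin t) (at t)"
      by (auto intro!: derivative_eq_intros)
    moreover have "0 \<le> t * sin t" using \<open>0 \<le> t\<close> \<open>t \<le> x\<close> that by (simp add: sin_ge_zero)
    ultimately show "\<exists>y. ((\<lambda>t. sin t - t * cos t) has_real_derivative y) (at t) \<and> 0 \<le> y"
      by blast
  qed
  then show ?thesis by simp
qed

lemma sinh_le_mult_cosh: "sinh x \<le> x * cosh x" if "0 \<le> x" for x :: real
proof -
  have "(\<lambda>t. t * cosh t - sinh t) 0 \<le> x * cosh x - sinh x"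
  proof (rule DERIV_nonneg_imp_nondecreasing[OF \<open>0 \<le> x\<close>])
    fix t assume "0 \<le> t" "t \<le> x"
    have "((\<lambda>t. t * cosh t - sinh t) has_real_derivative t * sinh t) (at t)"
      by (auto intro!: derivative_eq_intros)
    moreover have "0 \<le> t * sinh t" using \<open>0 \<le> t\<close> by simp
    ultimately show "\<exists>y. ((\<lambda>t. t * cosh t - sinh t) has_real_derivative y) (at t) \<and> 0 \<le> y"
      by blast
  qed
  then show ?thesis by simp
qed

lemma cosh_mult_cos_norm_le:
  fixes z :: complex
  assumes "norm z \<le> pi / 2"
  shows "cosh (Re z) * cos (norm z) \<le> cos (Im z)"
proof (cases "z = 0")
  case False
  define \<rho> where "\<rho> = norm z"
  have \<rho>: "0 < \<rho>" "\<rho> \<le> pi / 2" using False assms by (simp_all add: \<rho>_def)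
  have "(\<bar>Im z\<bar> / \<rho>)\<^sup>2 + (\<bar>Re z\<bar> / \<rho>)\<^sup>2 = ((Re z)\<^sup>2 + (Im z)\<^sup>2) / \<rho>\<^sup>2"
    by (simp add: power_divide add_divide_distrib)
  also have "\<dots> = 1" using \<rho> by (simp add: \<rho>_def flip: cmod_power2)
  \<comment> \<open>After reflecting \<open>z\<close> into the first quadrant,
    \<open>\<theta>\<close> is its angle from the imaginary axis, so \<open>t = 0\<close> below
    stands for the point \<open>\<i> \<rho>\<close>.\<close>
  finally obtain \<theta> where \<theta>: "0 \<le> \<theta>" "\<theta> \<le> pi / 2" "\<bar>Im z\<bar> / \<rho> = cos \<theta>" "\<bar>Re z\<bar> / \<rho> = sin \<theta>"
    using sincos_total_pi_half[of "\<bar>Im z\<bar> / \<rho>" "\<bar>Re z\<bar> / \<rho>"] \<rho> by auto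
  txt \<open>Moving along the circle \<open>|z| = \<rho>\<close>, the quotient \<open>cos (Im z) / cosh (Re z)\<close> increases away from the imaginary axis.\<close>
  define F where "F t = cos (\<rho> * cos t) / cosh (\<rho> * sin t)" for t
  have "F 0 \<le> F \<theta>"
  proof (rule DERIV_nonneg_imp_nondecreasing[OF \<theta>(1)])
    fix t assume t: "0 \<le> t" "t \<le> \<theta>"
    define X Y where "X = \<rho> * sin t" and "Y = \<rho> * cos t"
    have "0 \<le> sin t" "0 \<le> cos t" using t \<theta> by (auto intro!: sin_ge_zero cos_ge_zero)
    have "Y \<le> \<rho>"
      unfolding Y_def using \<rho> by (intro mult_left_le) auto
    with \<rho> have "Y \<le> pi / 2" by linarith
    moreover have "0 \<le> X" "0 \<le> Y"
      using \<rho> \<open>0 \<le> sin t\<close> \<open>0 \<le> cos t\<close> by (simp_all add: X_def Y_def)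
    ultimately have X: "0 \<le> X" and Y: "0 \<le> Y" "Y \<le> pi / 2" by auto
    have "(F has_real_derivative (X * sin Y * cosh X - cos Y * (Y * sinh X)) / (cosh X)\<^sup>2) (at t)"
      unfolding F_def X_def Y_def
      by (auto intro!: derivative_eq_intros simp: power2_eq_square mult_ac)
    \<comment> \<open>The product of \<open>Y cos Y \<le> sin Y\<close> and
      \<open>sinh X \<le> X cosh X\<close> makes the numerator nonnegative.\<close>
    moreover have "(Y * cos Y) * sinh X \<le> sin Y * (X * cosh X)"
      using X Y mult_cos_le_sin[of Y] sinh_le_mult_cosh[of X]
      by (intro mult_mono) (auto intro!: sin_ge_zero)
    then have "0 \<le> (X * sin Y * cosh X - cos Y * (Y * sinh X)) / (cosh X)\<^sup>2"
      by (intro divide_nonneg_nonneg) (auto simp: mult_ac)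
    ultimately show "\<exists>y. (F has_real_derivative y) (at t) \<and> 0 \<le> y" by blast
  qed
  moreover have "\<rho> * cos \<theta> = \<bar>Im z\<bar>" "\<rho> * sin \<theta> = \<bar>Re z\<bar>"
    using \<rho> by (simp_all flip: \<theta>(3,4))
  ultimately show ?thesis
    by (simp add: F_def \<rho>_def pos_le_divide_eq mult.commute)
qed simp

text \<open>The squared modulus is \<open>(cosh X - cos Y) / (cosh X + cos Y)\<close>, which
  increases with \<open>cosh X / cos Y\<close>. That ratio is at most \<open>1 / cos r\<close>, and
  \<open>(1 - cos r) / (1 + cos r)\<close> is the square of \<open>tan (r/2)\<close>.\<close>

lemma norm_logistic_minus_1_le:
  fixes z :: complex
  assumes z: "norm z \<le> r" and r: "r < pi / 2"
  shows "norm (2 / (1 + exp (- z)) - 1) \<le> tan (r / 2)"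
proof -
  define X Y where "X = Re z" and "Y = Im z"
  have r0: "0 \<le> r" using z norm_ge_zero[of z] by linarith
  have cr: "cos r > 0" "cos (r / 2) > 0" "sin (r / 2) \<ge> 0"
    using r0 r by (auto intro!: cos_gt_zero_pi sin_ge_zero)
  have "cos r \<le> cos (norm z)" using z r pi_gt_zero norm_ge_zero[of z] by (intro cos_monotone_0_pi_le) linarith+
  then have "cosh X * cos r \<le> cosh X * cos (norm z)" by (intro mult_left_mono) auto
  also have "\<dots> \<le> cos Y" using cosh_mult_cos_norm_le[of z] z r by (simp add: X_def Y_def)
  finally have le: "cosh X * cos r \<le> cos Y" .
  have cY: "cos Y > 0"
    using le cr by (meson cosh_real_pos less_le_trans mult_pos_pos)
  have n: "(norm (1 + of_real s * exp (- z)))\<^sup>2 = 2 * exp (- X) * (cosh X + s * cos Y)" if "s\<^sup>2 = 1" for s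
  proof -
    have "(norm (1 + of_real s * exp (- z)))\<^sup>2
      = 1 + 2 * s * (exp (- X) * cos Y) + s\<^sup>2 * (exp (- X))\<^sup>2 * ((cos Y)\<^sup>2 + (sin Y)\<^sup>2)"
      unfolding cmod_power2
      by (simp add: Re_exp Im_exp X_def Y_def power2_eq_square algebra_simps
          del: sin_cos_squared_add sin_cos_squared_add2 sin_cos_squared_add3)
    also have "\<dots> = 1 + 2 * s * (exp (- X) * cos Y) + (exp (- X))\<^sup>2"
      using that by simp
    also have "\<dots> = 2 * exp (- X) * (cosh X + s * cos Y)"
      by (simp add: cosh_field_def power2_eq_square algebra_simps exp_minus_inverse flip: exp_add)
    finally show ?thesis .
  qed
  have pos: "cosh X + cos Y > 0" using cY by (simp add: add_pos_pos)
  have nz: "1 + exp (- z) \<noteq> 0" using n[of 1] pos by auto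
  have "2 / (1 + exp (- z)) - 1 = (1 - exp (- z)) / (1 + exp (- z))"
    using nz by (simp add: field_simps)
  then have "(norm (2 / (1 + exp (- z)) - 1))\<^sup>2 = (cosh X - cos Y) / (cosh X + cos Y)"
    using n[of 1] n[of "-1"] by (simp add: norm_divide power_divide)
  also have "\<dots> \<le> (tan (r / 2))\<^sup>2"
  proof -
    \<comment> \<open>Half-angle forms of both \<open>cos r\<close> and \<open>1\<close> turn
      \<open>le\<close> into the cross-multiplied claim.\<close>
    have d: "cos r = (cos (r / 2))\<^sup>2 - (sin (r / 2))\<^sup>2" "1 = (cos (r / 2))\<^sup>2 + (sin (r / 2))\<^sup>2"
      using cos_double[of "r / 2"] by auto
    have "(cosh X - cos Y) * (cos (r / 2))\<^sup>2 \<le> (sin (r / 2))\<^sup>2 * (cosh X + cos Y)"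
    proof -
      have "cosh X * ((cos (r / 2))\<^sup>2 - (sin (r / 2))\<^sup>2) \<le> cos Y * ((cos (r / 2))\<^sup>2 + (sin (r / 2))\<^sup>2)"
        using le d by simp
      moreover have "(a - b) * p \<le> q * (a + b)" if "a * (p - q) \<le> b * (p + q)" for a b p q :: real
        using that by (simp add: algebra_simps)
      ultimately show ?thesis by blast
    qed
    moreover have "(cos (r / 2))\<^sup>2 > 0" using cr by simp
    ultimately show ?thesis
      unfolding tan_def power_divide using pos
      by (simp only: pos_divide_le_eq times_divide_eq_left pos_le_divide_eq)
  qed
  finally show ?thesis
    by (rule power2_le_imp_le) (use cr in \<open>simp add: tan_def\<close>)
qed

section \<open>Subordination\<close>

text \<open>The subordinating function is \<open>sinh (p z - 1)\<close>, controlled by the Schwarz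
  lemma. To undo \<open>sinh\<close>, \<open>p - 1\<close> must stay in the strip
  \<open>|Im| < pi/2\<close>: it starts at \<open>0\<close> and cannot meet the boundary, where
  \<open>|sinh| \<ge> 1\<close>.\<close>

lemma subordinate_one_plus_arsinh:
  assumes hol: "p holomorphic_on ball 0 1" and p0: "p 0 = 1"
    and less: "\<And>z. norm z < 1 \<Longrightarrow> norm (sinh (p z - 1)) < 1"
  shows "p \<prec>\<^sub>s (\<lambda>z. 1 + arsinh z)"
proof -
  define w where "w z = sinh (p z - 1)" for z
  have whol: "w holomorphic_on ball 0 1"
    unfolding w_def sinh_field_def by (intro holomorphic_intros hol) auto
  have "norm (w z) \<le> norm z" if "norm z < 1" for z
    using Schwarz_Lemma(1)[OF whol] less that by (simp add: w_def p0)
  moreover have "p z = 1 + arsinh (w z)" if z: "norm z < 1" for z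
  proof -
    have "\<bar>Im (p z - 1)\<bar> < pi / 2"
    proof (rule ccontr)
      assume "\<not> ?thesis"
      \<comment> \<open>The intermediate value theorem on the segment from \<open>0\<close> to
        \<open>z\<close> finds a point with \<open>|Im (p - 1)| = pi/2\<close>.\<close>
      have seg: "norm (of_real t * z) < 1" if "t \<in> {0..1}" for t :: real
        using that z mult_left_le_one_le[of "norm z" t] by (simp add: norm_mult)
      define \<phi> where "\<phi> t = \<bar>Im (p (of_real t * z) - 1)\<bar>" for t :: real
      have "continuous_on {0..1} \<phi>"
        unfolding \<phi>_def using seg
        by (intro continuous_intros
            continuous_on_compose2[OF holomorphic_on_imp_continuous_on[OF hol]]) auto
      then obtain t where t: "0 \<le> t" "t \<le> 1" "\<phi> t = pi / 2"
        using IVT'[of \<phi> 0 "pi / 2" 1] \<open>\<not> _\<close> by (auto simp: \<phi>_def p0)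
      define v where "v = p (of_real t * z) - 1"
      have Im_v: "\<bar>Im v\<bar> = pi / 2" using t(3) by (simp add: \<phi>_def v_def)
      have "(sin (Im v))\<^sup>2 = (sin \<bar>Im v\<bar>)\<^sup>2" by (simp add: abs_if)
      also have "\<dots> = 1" unfolding Im_v by simp
      finally have "(norm (sinh v))\<^sup>2 \<ge> 1" by (simp add: norm_sinh_squared)
      moreover have "(norm (sinh v))\<^sup>2 < 1"
        using less[OF seg] t by (simp add: v_def abs_square_less_1)
      ultimately show False by simp
    qed
    then show ?thesis by (simp add: w_def arsinh_sinh_complex)
  qed
  moreover have "w 0 = 0" by (simp add: w_def p0)
  moreover have "(\<lambda>z. 1 + arsinh z) holomorphic_on ball (0 :: complex) 1"
    by (intro holomorphic_on_add holomorphic_on_const holomorphic_on_arsinh)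
  ultimately show ?thesis
    unfolding subordinate_def using whol hol by (intro conjI exI[of _ w]) auto
qed

text \<open>Holds even where \<open>f\<close> is not differentiable, because the difference
  quotients coincide.\<close>

lemma deriv_diff_const: "deriv (\<lambda>x. f x - c) = deriv f"
  by (rule ext) (simp add: deriv_def has_field_derivative_iff)

text \<open>Reduces each case to a bound on \<open>|h - 1|\<close> over the open disc, since
  \<open>S_op\<close> takes values \<open>h (w z)\<close> with \<open>|w z| < 1\<close>.\<close>

lemma starlike_rhoI:
  assumes f: "f \<in> class_A" and \<beta>: "\<beta>2 > 0" "2 * \<beta>1 - \<beta>2 > 0"
    and sub: "S_op \<beta>1 \<beta>2 f \<prec>\<^sub>s h"
    and h: "\<And>w. norm w < 1 \<Longrightarrow> norm (h w - 1) < (2 * \<beta>1 - \<beta>2) / (2 * sqrt 2)"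
  shows "f \<in> starlike_rho"
proof -
  have hol: "S_op \<beta>1 \<beta>2 f holomorphic_on ball 0 1" using sub by (simp add: subordinate_def)
  have nz: "f z \<noteq> 0" if "norm z < 1" "z \<noteq> 0" for z
    using S_op_holomorphic_imp_nonzero[OF f hol _ that] \<beta>(1) by simp
  have S1: "S_quot 1 f holomorphic_on ball 0 1" "S_quot 1 f 0 = 1"
    using S_quot_1_holomorphic[OF f] nz by blast+
  have "norm (sinh (S_quot 1 f z - 1)) < 1" if "norm z < 1" for z
  proof (rule norm_sinh_less_1[OF _ _ \<beta> _ that])
    fix z :: complex assume z: "norm z < 1" "z \<noteq> 0"
    obtain w where "\<forall>z\<in>ball 0 1. norm (w z) \<le> norm z" "\<forall>z\<in>ball 0 1. S_op \<beta>1 \<beta>2 f z = h (w z)"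
      using sub unfolding subordinate_def by blast
    with z have "norm (w z) \<le> norm z" "S_op \<beta>1 \<beta>2 f z = h (w z)" by auto
    with h[of "w z"] z have "norm (S_op \<beta>1 \<beta>2 f z - 1) < (2 * \<beta>1 - \<beta>2) / (2 * sqrt 2)"
      by simp
    then show "norm (of_real \<beta>1 * (z * deriv (\<lambda>z. S_quot 1 f z - 1) z)
        + of_real \<beta>2 * (z\<^sup>2 * deriv (deriv (\<lambda>z. S_quot 1 f z - 1)) z))
        < (2 * \<beta>1 - \<beta>2) / (2 * sqrt 2)"
      using S_op_eq_S_quot_1[OF f nz z, of \<beta>1 \<beta>2]
      by (simp add: deriv_diff_const add.assoc del: One_nat_def)
  qed (use S1 in \<open>auto intro!: holomorphic_intros simp del: One_nat_def\<close>)
  then have "S_quot 1 f \<prec>\<^sub>s (\<lambda>z. 1 + arsinh z)"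
    by (rule subordinate_one_plus_arsinh[OF S1])
  with f show ?thesis by (simp add: starlike_rho_def)
qed

section \<open>The eight dominating functions\<close>

theorem corollary3p9:
  fixes \<beta>1 \<beta>2 :: real and f :: "complex \<Rightarrow> complex"
  assumes "\<beta>1 > 0" and "\<beta>2 > 0" and "f \<in> class_A"
    and "(S_op \<beta>1 \<beta>2 f \<prec>\<^sub>s (\<lambda>z. csqrt (1 + z)) \<and>
            2 * \<beta>1 - \<beta>2 > 0 \<and> (2 * \<beta>1 - \<beta>2) * (2 * \<beta>1 - \<beta>2 - 4 * sqrt 2) \<ge> 8) \<or>
         (\<exists>C D :: real. -1 < D \<and> D < C \<and> C \<le> 1 \<and>
            S_op \<beta>1 \<beta>2 f \<prec>\<^sub>s (\<lambda>z. (1 + of_real C * z) / (1 + of_real D * z)) \<and>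
            (2 * \<beta>1 - \<beta>2) * (1 - D\<^sup>2) \<ge> 2 * sqrt 2 * (C - D) * (1 + \<bar>D\<bar>)) \<or>
         (S_op \<beta>1 \<beta>2 f \<prec>\<^sub>s (\<lambda>z. 2 / (1 + exp (- z))) \<and> 2 * \<beta>1 - \<beta>2 \<ge> 2 * sqrt 2 * r0) \<or>
         (S_op \<beta>1 \<beta>2 f \<prec>\<^sub>s (\<lambda>z. z + csqrt (1 + z\<^sup>2)) \<and> 2 * \<beta>1 - \<beta>2 \<ge> 4) \<or>
         (S_op \<beta>1 \<beta>2 f \<prec>\<^sub>s (\<lambda>z. 1 + sin z) \<and> 2 * \<beta>1 - \<beta>2 \<ge> 2 * sqrt 2 * sinh 1) \<or>
         (S_op \<beta>1 \<beta>2 f \<prec>\<^sub>s (\<lambda>z. 1 + z * exp z) \<and> 2 * \<beta>1 - \<beta>2 \<ge> 2 * sqrt 2 * exp 1) \<or>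
         (S_op \<beta>1 \<beta>2 f \<prec>\<^sub>s (\<lambda>z. exp z) \<and> 2 * \<beta>1 - \<beta>2 \<ge> 2 * sqrt 2 * (exp 1 - 1)) \<or>
         (S_op \<beta>1 \<beta>2 f \<prec>\<^sub>s (\<lambda>z. 1 + arsinh z) \<and> 2 * \<beta>1 - \<beta>2 \<ge> sqrt 2 * pi)"
  shows "f \<in> starlike_rho"
proof -
  define x where "x = 2 * \<beta>1 - \<beta>2"
  \<comment> \<open>\<open>M\<close> bounds \<open>|h - 1|\<close>. The cases use in turn
    \<open>1\<close>, \<open>(C - D) / (1 - |D|)\<close>, \<open>r0\<close>, \<open>sqrt 2\<close>,
    \<open>sinh 1\<close>, \<open>exp 1\<close>, \<open>exp 1 - 1\<close> and
    \<open>pi / 2\<close>.\<close>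
  have I: ?thesis if "S_op \<beta>1 \<beta>2 f \<prec>\<^sub>s h" "M > 0" "x \<ge> 2 * sqrt 2 * M"
    "\<And>w. norm w < 1 \<Longrightarrow> norm (h w - 1) < M" for h M
  proof (rule starlike_rhoI[OF assms(3,2) _ that(1)])
    have "0 < 2 * sqrt 2 * M" using that(2) by simp
    with that(3) show "2 * \<beta>1 - \<beta>2 > 0" unfolding x_def by linarith
    fix w :: complex assume "norm w < 1"
    moreover have "M \<le> x / (2 * sqrt 2)" using that(3) by (simp add: field_simps)
    ultimately show "norm (h w - 1) < (2 * \<beta>1 - \<beta>2) / (2 * sqrt 2)"
      using that(4) unfolding x_def by fastforce
  qed
  note cases = assms(4)[folded x_def]
  from cases show ?thesis
  proof (elim disjE exE conjE)
    assume sub: "S_op \<beta>1 \<beta>2 f \<prec>\<^sub>s (\<lambda>z. csqrt (1 + z))" and x: "0 < x" "8 \<le> x * (x - 4 * sqrt 2)"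
    show ?thesis
    proof (rule I[OF sub, of 1])
      \<comment> \<open>The quadratic inequality also has a branch of negative \<open>x\<close>;
        \<open>0 < x\<close> selects \<open>x > 4 sqrt 2\<close>, which exceeds
        \<open>2 sqrt 2\<close>.\<close>
      have "0 < x * (x - 4 * sqrt 2)" using x(2) by linarith
      then have "4 * sqrt 2 < x" using x(1) by (simp add: zero_less_mult_iff)
      moreover have "0 < sqrt (2 :: real)" by simp
      ultimately show "2 * sqrt 2 * 1 \<le> x" by linarith
    qed (use le_less_trans[OF norm_csqrt_minus_1_le] in auto)
  next
    fix C D :: real
    assume CD: "-1 < D" "D < C" "C \<le> 1"
      and sub: "S_op \<beta>1 \<beta>2 f \<prec>\<^sub>s (\<lambda>z. (1 + of_real C * z) / (1 + of_real D * z))"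
      and x: "2 * sqrt 2 * (C - D) * (1 + \<bar>D\<bar>) \<le> x * (1 - D\<^sup>2)"
    have D: "\<bar>D\<bar> < 1" using CD by auto
    show ?thesis
    \<comment> \<open>The bound comes from \<open>h w - 1 = (C - D) w / (1 + D w)\<close> and
      \<open>|1 + D w| \<ge> 1 - |D|\<close>; cancelling \<open>1 + |D|\<close> in the hypothesis
      gives the matching threshold.\<close>
    proof (rule I[OF sub, of "(C - D) / (1 - \<bar>D\<bar>)"])
      show "0 < (C - D) / (1 - \<bar>D\<bar>)" using CD D by simp
      have "1 - D\<^sup>2 = (1 - \<bar>D\<bar>) * (1 + \<bar>D\<bar>)"
        by (simp add: power2_eq_square algebra_simps)
      then have "(2 * sqrt 2 * (C - D)) * (1 + \<bar>D\<bar>) \<le> (x * (1 - \<bar>D\<bar>)) * (1 + \<bar>D\<bar>)"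
        using x by (simp only: mult.assoc)
      then have "2 * sqrt 2 * (C - D) \<le> x * (1 - \<bar>D\<bar>)"
        by (rule mult_right_le_imp_le) simp
      then show "2 * sqrt 2 * ((C - D) / (1 - \<bar>D\<bar>)) \<le> x"
        using D by (simp add: pos_divide_le_eq)
      fix w :: complex assume w: "norm w < 1"
      have "\<bar>D\<bar> * norm w \<le> \<bar>D\<bar>" using w by (intro mult_left_le) auto
      then have d: "1 - \<bar>D\<bar> \<le> norm (1 + of_real D * w)"
        using norm_diff_ineq[of 1 "of_real D * w"] by (simp add: norm_mult)
      then have nz: "1 + of_real D * w \<noteq> 0" using D by auto
      then have "(1 + of_real C * w) / (1 + of_real D * w) - 1 = of_real (C - D) * w / (1 + of_real D * w)"
        by (simp add: field_simps)
      then have "norm ((1 + of_real C * w) / (1 + of_real D * w) - 1)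
          = (C - D) * norm w / norm (1 + of_real D * w)"
        using CD by (simp add: norm_divide norm_mult del: of_real_diff)
      also have "\<dots> < (C - D) / (1 - \<bar>D\<bar>)"
        using CD D w d by (intro frac_less) auto
      finally show "norm ((1 + of_real C * w) / (1 + of_real D * w) - 1) < (C - D) / (1 - \<bar>D\<bar>)" .
    qed
  next
    assume sub: "S_op \<beta>1 \<beta>2 f \<prec>\<^sub>s (\<lambda>z. 2 / (1 + exp (- z)))" and x: "2 * sqrt 2 * r0 \<le> x"
    show ?thesis
    proof (rule I[OF sub _ x])
      show "0 < r0" unfolding r0_eq_tan using pi_gt3 by (intro tan_gt_zero) auto
      fix w :: complex assume w: "norm w < 1"
      \<comment> \<open>Taking the radius \<open>norm w\<close> instead of \<open>1\<close> keeps
        the final inequality strict.\<close>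
      then have "norm (2 / (1 + exp (- w)) - 1) \<le> tan (norm w / 2)"
        using pi_gt3 by (intro norm_logistic_minus_1_le) auto
      also have "\<dots> < r0" unfolding r0_eq_tan
        by (rule tan_monotone) (use w pi_gt3 norm_ge_zero[of w] in linarith)+
      finally show "norm (2 / (1 + exp (- w)) - 1) < r0" .
    qed
  next
    assume sub: "S_op \<beta>1 \<beta>2 f \<prec>\<^sub>s (\<lambda>z. z + csqrt (1 + z\<^sup>2))" and x: "4 \<le> x"
    show ?thesis
    proof (rule I[OF sub])
      show "0 < sqrt (2 :: real)" by simp
      show "2 * sqrt 2 * sqrt 2 \<le> x" using x by (simp add: mult.assoc)
    qed (rule norm_crescent_minus_1_less)
  next
    assume sub: "S_op \<beta>1 \<beta>2 f \<prec>\<^sub>s (\<lambda>z. 1 + sin z)" and x: "2 * sqrt 2 * sinh 1 \<le> x"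
    show ?thesis
    proof (rule I[OF sub _ x])
      show "norm (1 + sin w - 1) < sinh 1" if "norm w < 1" for w :: complex
        using le_less_trans[OF norm_sin_le_sinh, of w "sinh 1"] that by simp
    qed simp
  next
    assume sub: "S_op \<beta>1 \<beta>2 f \<prec>\<^sub>s (\<lambda>z. 1 + z * exp z)" and x: "2 * sqrt 2 * exp 1 \<le> x"
    show ?thesis
    proof (rule I[OF sub _ x])
      fix w :: complex assume w: "norm w < 1"
      have "norm (w * exp w) \<le> norm w * exp (norm w)"
        unfolding norm_mult by (intro mult_left_mono norm_exp) auto
      also have "\<dots> \<le> 1 * exp (norm w)" using w by (intro mult_right_mono) auto
      also have "\<dots> < exp 1" using w by simp
      finally show "norm (1 + w * exp w - 1) < exp 1" by simp
    qed simp
  next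
    assume sub: "S_op \<beta>1 \<beta>2 f \<prec>\<^sub>s exp" and x: "2 * sqrt 2 * (exp 1 - 1) \<le> x"
    show ?thesis
    proof (rule I[OF sub _ x])
      show "norm (exp w - 1) < exp 1 - 1" if "norm w < 1" for w :: complex
        using le_less_trans[OF norm_exp_minus_1_le, of w "exp 1 - 1"] that by simp
    qed simp
  next
    assume sub: "S_op \<beta>1 \<beta>2 f \<prec>\<^sub>s (\<lambda>z. 1 + arsinh z)" and x: "sqrt 2 * pi \<le> x"
    show ?thesis
    proof (rule I[OF sub])
      show "0 < pi / 2" by simp
      show "2 * sqrt 2 * (pi / 2) \<le> x" using x by simp
      show "norm (1 + arsinh w - 1) < pi / 2" if "norm w < 1" for w :: complex
        using norm_arsinh_less[OF that] by simp
    qed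
  qed
qed

end
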